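(* Consider a left-invariant Lorentzian problem on $G=\mathrm{Aff}_+(\mathbb R)$ given by a matrix $A=\begin{pmatrix}a&b\\c&d\end{pmatrix}$, $|A|>0$, $a\ge0$, with sectional curvature $K=0$. Let $q_1=(x_1,y_1)\in G$ and $d(q_1)=d(\mathrm{Id},q_1)$. (1) If $q_1\notin J^+$, then $d(q_1)=0$. (2) If $q_1\in\partial J^+$, then $d(q_1)=0$. (3) If $q_1\in\operatorname{int}J^+$, then $d(q_1)=\frac{\rho-\tau}{\gamma}$, where $$\tau=\sqrt{\frac{w}{y_1-y_1^2}},\qquad \rho=\sqrt{\frac{wy_1}{1-y_1}},\qquad w=\frac{x_1-\mathsf g(1-y_1)}{f}.$$ In particular, $d(\operatorname{int}J^+)=(0,+\infty)$.
   Context: $G=\mathrm{Aff}_+(\mathbb R)=\{(x,y)\in\mathbb R^2: y>0\}$ with product $(x_2,y_2)\cdot(x_1,y_1)=(x_2+y_2x_1,\,y_2y_1)$ and identity $\mathrm{Id}=(0,1)$; left-invariant frame $X_1=y\,\partial_x$, $X_2=y\,\partial_y$. A real matrix $A=\begin{pmatrix}a&b\\c&d\end{pmatrix}$ with $|A|=ad-bc>0$ determines the left-invariant Lorentzian form $g(u_1X_1+u_2X_2)=-v_1^2+v_2^2$, $v_1=au_1+bu_2$, $v_2=cu_1+du_2$, with time orientation in which future directed nonspacelike vectors are those with $v_1\ge|v_2|$. Standing assumption of the paper: $a\ge0$. Write $A^{-1}=\begin{pmatrix}\alpha&\beta\\ \gamma&\delta\end{pmatrix}$. The sectional curvature is $K=(c^2-a^2)/|A|^2=\gamma^2-\delta^2$.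 A future directed nonspacelike curve is a Lipschitz curve whose velocity is a.e. future directed nonspacelike; its Lorentzian length is $\int\sqrt{v_1^2-v_2^2}\,dt$. $J^+$ is the set of endpoints of such curves starting at $\mathrm{Id}$. The Lorentzian distance $d(q_0,q_1)$ is the supremum of lengths of such curves from $q_0$ to $q_1$, and $0$ if there are none. Boundaries and interiors are taken in $G$. For $K=0$: $s_1=\operatorname{sgn}\gamma$, $f=-\frac{\alpha-s_1\beta}{2\gamma}$, $\mathsf g=-\frac{\alpha+s_1\beta}{2\gamma}$. *)

theory Defs
  imports "HOL-Analysis.Analysis" "HOL-Algebra.Group"
begin

section \<open>The group of orientation-preserving affine maps of the line\<close>

definition aff :: "(real \<times> real) monoid" where
  "aff = \<lparr>carrier = {q. snd q > 0},
          mult = (\<lambda>p q. (fst p + snd p * fst q, snd p * snd q)),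
          one = (0, 1)\<rparr>"

lemma group_aff: "group aff"
proof (rule groupI)
  fix p assume p: "p \<in> carrier aff"
  show "\<exists>q\<in>carrier aff. q \<otimes>\<^bsub>aff\<^esub> p = \<one>\<^bsub>aff\<^esub>"
    using p by (intro bexI[where x = "(- fst p / snd p, 1 / snd p)"]) (auto simp: aff_def)
qed (auto simp: aff_def algebra_simps)

text \<open>A vector \<open>u\<close> of the Lie algebra stands for the left-invariant field
  \<open>u\<^sub>1 X\<^sub>1 + u\<^sub>2 X\<^sub>2\<close>, where \<open>X\<^sub>1 = y \<partial>\<^sub>x\<close> and \<open>X\<^sub>2 = y \<partial>\<^sub>y\<close>.\<close>

definition left_inv_field :: "real^2 \<Rightarrow> real \<times> real \<Rightarrow> real \<times> real" where
  "left_inv_field u q = (u$1) *\<^sub>R (snd q, 0) + (u$2) *\<^sub>R (0, snd q)"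

definition left_coords :: "real \<times> real \<Rightarrow> real \<times> real \<Rightarrow> real^2" where
  "left_coords q \<xi> = vector [fst \<xi> / snd q, snd \<xi> / snd q]"

lemma left_inv_field_coords:
  "q \<in> carrier aff \<Longrightarrow> left_inv_field (left_coords q \<xi>) q = \<xi>"
  by (auto simp: aff_def left_inv_field_def left_coords_def prod_eq_iff)

lemma left_inv_field_left_invariant:
  "frechet_derivative (\<lambda>r. p \<otimes>\<^bsub>aff\<^esub> r) (at q) (left_inv_field u q)
     = left_inv_field u (p \<otimes>\<^bsub>aff\<^esub> q)"
proof -
  have "((\<lambda>r. p \<otimes>\<^bsub>aff\<^esub> r) has_derivative (\<lambda>h. (snd p * fst h, snd p * snd h))) (at q)"
    unfolding aff_def by (auto intro!: derivative_eq_intros)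
  then have "frechet_derivative (\<lambda>r. p \<otimes>\<^bsub>aff\<^esub> r) (at q) = (\<lambda>h. (snd p * fst h, snd p * snd h))"
    by (rule frechet_derivative_at[symmetric])
  then show ?thesis
    by (simp add: left_inv_field_def aff_def algebra_simps)
qed

definition lie_bracket :: "real^2 \<Rightarrow> real^2 \<Rightarrow> real^2" where
  "lie_bracket u v = vector [u$2 * v$1 - u$1 * v$2, 0]"

lemma lie_bracket_left_inv_field:
  "frechet_derivative (left_inv_field v) (at q) (left_inv_field u q)
     - frechet_derivative (left_inv_field u) (at q) (left_inv_field v q)
     = left_inv_field (lie_bracket u v) q"
proof -
  have "(left_inv_field w has_derivative (\<lambda>h. (w$1 * snd h, w$2 * snd h))) (at q)" for w
    unfolding left_inv_field_def[abs_def] by (auto intro!: derivative_eq_intros)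
  then have "frechet_derivative (left_inv_field w) (at q) = (\<lambda>h. (w$1 * snd h, w$2 * snd h))" for w
    by (metis frechet_derivative_at)
  then show ?thesis
    by (simp add: left_inv_field_def lie_bracket_def algebra_simps)
qed

section \<open>Left-invariant Lorentzian structures\<close>

text \<open>The polarization of \<open>- v\<^sub>1\<^sup>2 + v\<^sub>2\<^sup>2\<close> with \<open>v = A u\<close>.\<close>

definition lorentz_form :: "real^2^2 \<Rightarrow> real^2 \<Rightarrow> real^2 \<Rightarrow> real" where
  "lorentz_form A u w = - ((A *v u)$1 * (A *v w)$1) + (A *v u)$2 * (A *v w)$2"

definition future_nonspacelike :: "real^2^2 \<Rightarrow> real^2 \<Rightarrow> bool" where
  "future_nonspacelike A u \<longleftrightarrow> (A *v u)$1 \<ge> \<bar>(A *v u)$2\<bar>"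

text \<open>Levi-Civita connection on left-invariant fields. In the Koszul formula the terms that
  differentiate inner products vanish, since these are constant on \<open>G\<close>.\<close>

definition levi_civita :: "real^2^2 \<Rightarrow> real^2 \<Rightarrow> real^2 \<Rightarrow> real^2" where
  "levi_civita A u v = (THE z. \<forall>w. 2 * lorentz_form A z w =
      lorentz_form A (lie_bracket u v) w
    - lorentz_form A (lie_bracket v w) u
    + lorentz_form A (lie_bracket w u) v)"

definition curvature :: "real^2^2 \<Rightarrow> real^2 \<Rightarrow> real^2 \<Rightarrow> real^2 \<Rightarrow> real^2" where
  "curvature A u v w = levi_civita A u (levi_civita A v w)
    - levi_civita A v (levi_civita A u w) - levi_civita A (lie_bracket u v) w"

text \<open>The group is two-dimensional, so there is only one tangent plane, spanned by
  \<open>X\<^sub>1\<close> and \<open>X\<^sub>2\<close>.\<close>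

definition sectional_curvature :: "real^2^2 \<Rightarrow> real" where
  "sectional_curvature A = (let e1 = axis 1 1; e2 = axis 2 1 in
     lorentz_form A (curvature A e1 e2 e2) e1 /
     (lorentz_form A e1 e1 * lorentz_form A e2 e2 - (lorentz_form A e1 e2)\<^sup>2))"

lemma lorentz_form_expand:
  "lorentz_form A u w =
     ((A$2$1)\<^sup>2 - (A$1$1)\<^sup>2) * (u$1 * w$1)
   + (A$2$1 * A$2$2 - A$1$1 * A$1$2) * (u$1 * w$2 + u$2 * w$1)
   + ((A$2$2)\<^sup>2 - (A$1$2)\<^sup>2) * (u$2 * w$2)"
  by (simp add: lorentz_form_def matrix_vector_mult_def sum_2 power2_eq_square algebra_simps)

lemma levi_civita_eq:
  fixes A :: "real^2^2"
  defines "E \<equiv> (A$2$1)\<^sup>2 - (A$1$1)\<^sup>2"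
    and "F \<equiv> A$2$1 * A$2$2 - A$1$1 * A$1$2"
    and "H \<equiv> (A$2$2)\<^sup>2 - (A$1$2)\<^sup>2"
  assumes "det A \<noteq> 0"
  shows "levi_civita A u v =
    ((E * u$1 + F * u$2) / (E * H - F\<^sup>2)) *\<^sub>R vector [- F * v$1 - H * v$2, E * v$1 + F * v$2]"
    (is "_ = ?z")
proof -
  have "E * H - F\<^sup>2 = - (det A)\<^sup>2"
    unfolding E_def F_def H_def det_2 by (simp add: power2_eq_square algebra_simps)
  then have D: "E * H - F\<^sup>2 \<noteq> 0" using assms(4) by simp
  have form: "lorentz_form A p q =
      E * (p$1 * q$1) + F * (p$1 * q$2 + p$2 * q$1) + H * (p$2 * q$2)" for p q
    unfolding E_def F_def H_def by (rule lorentz_form_expand)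
  define m where "m = E * u$1 + F * u$2"
  have koszul: "lorentz_form A (lie_bracket u v) w - lorentz_form A (lie_bracket v w) u
      + lorentz_form A (lie_bracket w u) v = 2 * m * (v$1 * w$2 - v$2 * w$1)" for w
    unfolding form m_def by (simp add: lie_bracket_def algebra_simps)
  show ?thesis
    unfolding levi_civita_def koszul
  proof (rule the_equality)
    have "lorentz_form A ?z w = (m / (E * H - F\<^sup>2)) * ((E * H - F\<^sup>2) * (v$1 * w$2 - v$2 * w$1))" for w
      unfolding form m_def[symmetric]
      by (simp add: power2_eq_square algebra_simps add_divide_distrib diff_divide_distrib)
    then show "\<forall>w. 2 * lorentz_form A ?z w = 2 * m * (v$1 * w$2 - v$2 * w$1)"
      using D by simp
  next
    fix z
    assume z: "\<forall>w. 2 * lorentz_form A z w = 2 * m * (v$1 * w$2 - v$2 * w$1)"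
    have 1: "E * z$1 + F * z$2 = - m * v$2"
      using z[rule_format, of "vector [1, 0]"] by (simp add: form)
    have 2: "F * z$1 + H * z$2 = m * v$1"
      using z[rule_format, of "vector [0, 1]"] by (simp add: form)
    have "(E * H - F\<^sup>2) * z$1 = H * (E * z$1 + F * z$2) - F * (F * z$1 + H * z$2)"
      by (simp add: power2_eq_square algebra_simps)
    then have z1: "z$1 = m * (- F * v$1 - H * v$2) / (E * H - F\<^sup>2)"
      using D unfolding 1 2 by (simp add: eq_divide_eq algebra_simps)
    have "(E * H - F\<^sup>2) * z$2 = E * (F * z$1 + H * z$2) - F * (E * z$1 + F * z$2)"
      by (simp add: power2_eq_square algebra_simps)
    then have z2: "z$2 = m * (E * v$1 + F * v$2) / (E * H - F\<^sup>2)"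
      using D unfolding 1 2 by (simp add: eq_divide_eq algebra_simps)
    show "z = ?z"
      unfolding vec_eq_iff forall_2 m_def[symmetric] using z1 z2 by simp
  qed
qed

lemma sectional_curvature_eq:
  assumes "det A \<noteq> 0"
  shows "sectional_curvature A = ((A$2$1)\<^sup>2 - (A$1$1)\<^sup>2) / (det A)\<^sup>2"
proof -
  define E F H where "E = (A$2$1)\<^sup>2 - (A$1$1)\<^sup>2"
    and "F = A$2$1 * A$2$2 - A$1$1 * A$1$2" and "H = (A$2$2)\<^sup>2 - (A$1$2)\<^sup>2"
  define D where "D = E * H - F\<^sup>2"
  have D: "D = - (det A)\<^sup>2"
    unfolding D_def E_def F_def H_def det_2 by (simp add: power2_eq_square algebra_simps)
  then have "D \<noteq> 0" using assms by simp
  have form: "lorentz_form A p q =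
      E * (p$1 * q$1) + F * (p$1 * q$2 + p$2 * q$1) + H * (p$2 * q$2)" for p q
    unfolding E_def F_def H_def by (rule lorentz_form_expand)
  note lc = levi_civita_eq[OF assms, folded E_def F_def H_def, folded D_def]
  let ?e1 = "axis 1 1 :: real^2" and ?e2 = "axis 2 1 :: real^2"
  have e: "?e1 $ 1 = 1" "?e1 $ 2 = 0" "?e2 $ 1 = 0" "?e2 $ 2 = 1"
    by (simp_all add: axis_def)
  have "curvature A ?e1 ?e2 ?e2 = (E / D) *\<^sub>R vector [- H, F]"
    unfolding curvature_def lc vec_eq_iff forall_2
    by (simp add: lie_bracket_def e algebra_simps)
  then have "lorentz_form A (curvature A ?e1 ?e2 ?e2) ?e1 = - (E / D) * D"
    by (simp add: form e D_def power2_eq_square algebra_simps diff_divide_distrib)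
  then have "sectional_curvature A = - E / D"
    using \<open>D \<noteq> 0\<close> by (simp add: sectional_curvature_def form e D_def power2_eq_square)
  then show ?thesis by (simp add: D E_def minus_divide_left)
qed

section \<open>Nonspacelike curves and the Lorentzian distance\<close>

definition velocity :: "real \<Rightarrow> real \<Rightarrow> (real \<Rightarrow> real \<times> real) \<Rightarrow> real \<Rightarrow> real^2" where
  "velocity t0 t1 c t = left_coords (c t) (vector_derivative c (at t within {t0..t1}))"

definition nonspacelike_curve ::
    "real^2^2 \<Rightarrow> real \<Rightarrow> real \<Rightarrow> (real \<Rightarrow> real \<times> real) \<Rightarrow> bool" where
  "nonspacelike_curve A t0 t1 c \<longleftrightarrow>
     t0 < t1 \<and> c ` {t0..t1} \<subseteq> carrier aff \<and> (\<exists>L. L-lipschitz_on {t0..t1} c) \<and>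
     (AE t\<in>{t0..t1} in lebesgue. c differentiable (at t within {t0..t1}) \<and>
        future_nonspacelike A (velocity t0 t1 c t))"

definition lorentz_length ::
    "real^2^2 \<Rightarrow> real \<Rightarrow> real \<Rightarrow> (real \<Rightarrow> real \<times> real) \<Rightarrow> real" where
  "lorentz_length A t0 t1 c = integral {t0..t1}
     (\<lambda>t. sqrt (- lorentz_form A (velocity t0 t1 c t) (velocity t0 t1 c t)))"

definition lengths :: "real^2^2 \<Rightarrow> real \<times> real \<Rightarrow> real \<times> real \<Rightarrow> real set" where
  "lengths A p q = {lorentz_length A t0 t1 c | t0 t1 c.
     nonspacelike_curve A t0 t1 c \<and> c t0 = p \<and> c t1 = q}"

text \<open>Extended reals, because the lengths of the curves between two points may be unbounded.\<close>

definition lorentz_dist :: "real^2^2 \<Rightarrow> real \<times> real \<Rightarrow> real \<times> real \<Rightarrow> ereal" where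
  "lorentz_dist A p q = (if lengths A p q = {} then 0 else Sup (ereal ` lengths A p q))"

definition causal_future :: "real^2^2 \<Rightarrow> (real \<times> real) set" where
  "causal_future A = {q. \<exists>t0 t1 c. nonspacelike_curve A t0 t1 c \<and> c t0 = \<one>\<^bsub>aff\<^esub> \<and> c t1 = q}"

end

theory Submission
  imports Defs
begin

text \<open>Zero curvature means that the Lorentzian structure is flat, and the whole proof consists in
  writing it in global flat null coordinates. For \<open>K = 0\<close> one has \<open>c = - s a\<close> with
  \<open>s = sgn \<gamma>\<close>. Set
  \<open>p = s (1 - 1 / y)\<close> and \<open>z = x + k (y - 1)\<close>, where \<open>k = (b - s d) / (2 a)\<close>. The two null
  components \<open>v\<^sub>1 + s v\<^sub>2\<close> and \<open>v\<^sub>1 - s v\<^sub>2\<close> of a velocity are positive multiples of its \<open>p\<close>- and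
  \<open>z\<close>-components, and \<open>v\<^sub>1\<^sup>2 - v\<^sub>2\<^sup>2 = 2 |A| dp dz\<close>. The coordinates \<open>(p, z)\<close> thus identify \<open>G\<close> with the
  open half-plane \<open>s p < 1\<close> of the Minkowski plane with metric \<open>- 2 |A| dp dz\<close>, the future cone
  being \<open>dp \<ge> 0\<close>, \<open>dz \<ge> 0\<close>, and \<open>\<one>\<close> with the origin.\<close>

text \<open>In a half-plane of the Minkowski plane the problem is elementary. Along a nonspacelike curve
  \<open>p\<close> and \<open>z\<close> increase, and Cauchy--Schwarz bounds its length by \<open>\<surd>(2 |A| \<Delta>p \<Delta>z)\<close>. A half-plane is
  convex, so the straight segment between two causally related points stays in \<open>G\<close>, and it attains
  the bound. Hence the distance between any two points is \<open>\<surd>(2 |A| \<Delta>p \<Delta>z)\<close> if \<open>\<Delta>p, \<Delta>z \<ge> 0\<close> and \<open>0\<close>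
  otherwise (\<open>lorentz_dist_eq\<close>). The set \<open>J\<^sup>+\<close> is the closed quadrant and its interior is
  the open one (\<open>causal_future_eq\<close>, \<open>interior_causal_future\<close>); outside the open quadrant the distance
  from \<open>\<one>\<close> vanishes. What remains is to recognise the closed formula: \<open>\<rho> = y\<^sub>1 \<tau>\<close>, and
  \<open>(\<rho> - \<tau>) / \<gamma>\<close> equals \<open>\<surd>(2 |A| p z)\<close>.\<close>

text \<open>Curves are only Lipschitz, so their increments must be recovered from derivatives that
  exist almost everywhere. This is the version of the fundamental theorem of calculus proved
  first. The length is a Henstock--Kurzweil integral, whose value is \<open>0\<close> when the integrand is not
  integrable; the bound from above holds in that case too, since it is nonnegative.\<close>

section \<open>The fundamental theorem of calculus for Lipschitz functions\<close>

text \<open>The usual straddle estimate controls the pieces of a fine tagged division whose tag lies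
  outside \<open>N\<close>. A piece tagged in \<open>N\<close> contributes at most \<open>L\<close> times its length, and the pieces tagged
  in \<open>N\<close> have small total length because the indicator function of \<open>N\<close> has integral \<open>0\<close>.\<close>

theorem fundamental_theorem_of_calculus_lipschitz:
  fixes f :: "real \<Rightarrow> 'a::banach"
  assumes "a \<le> b" and lip: "L-lipschitz_on {a..b} f" and neg: "negligible N"
    and vecd: "\<And>x. x \<in> {a..b} - N \<Longrightarrow> (f has_vector_derivative f' x) (at x within {a..b})"
  shows "(f' has_integral (f b - f a)) {a..b}"
proof -
  define g where "g x = (if x \<in> N then 0 else f' x)" for x
  have L: "L \<ge> 0" using lip lipschitz_on_nonneg by blast
  have "(g has_integral (f b - f a)) {a..b}"
    unfolding has_integral_real
  proof (intro allI impI)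
    fix e :: real assume e: "e > 0"
    \<comment> \<open>This tolerance leaves room for an error \<open>\<eta>\<close> per unit length on \<open>[a, b]\<close> and for an
      error \<open>L \<eta>\<close> on the exceptional set.\<close>
    define \<eta> where "\<eta> = e / (b - a + L + 1)"
    have den: "b - a + L + 1 > 0" using \<open>a \<le> b\<close> L by linarith
    have \<eta>: "\<eta> > 0" using e den by (simp add: \<eta>_def)
    have "\<eta> * (b - a + L + 1) = e" using den by (simp add: \<eta>_def)
    then have \<eta>e: "\<eta> * (b - a) + L * \<eta> < e" using \<eta> by (simp add: algebra_simps)
    have "\<forall>x. \<exists>d>0. x \<in> {a..b} - N \<longrightarrow>
         (\<forall>y\<in>{a..b}. norm (y-x) < d \<longrightarrow> norm (f y - f x - (y-x) *\<^sub>R f' x) \<le> \<eta> * norm (y-x))"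
      using vecd[unfolded has_vector_derivative_def has_derivative_within_alt] \<eta> by (meson zero_less_one)
    then obtain d where dpos: "\<And>x. 0 < d x"
      and d: "\<And>x y. \<lbrakk>x \<in> {a..b} - N; y \<in> {a..b}; norm (y-x) < d x\<rbrakk>
                  \<Longrightarrow> norm (f y - f x - (y-x) *\<^sub>R f' x) \<le> \<eta> * norm (y-x)"
      by metis
    have "((indicator N :: real \<Rightarrow> real) has_integral 0) {a..b}"
      using neg unfolding negligible_def by (metis box_real(2))
    then obtain \<gamma> where \<gamma>: "gauge \<gamma>"
      and \<gamma>N: "\<And>p. \<lbrakk>p tagged_division_of {a..b}; \<gamma> fine p\<rbrakk>
          \<Longrightarrow> norm ((\<Sum>(x,K)\<in>p. measure lborel K *\<^sub>R (indicator N x :: real)) - 0) < \<eta>"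
      unfolding has_integral_real using \<eta> by meson
    show "\<exists>\<gamma>. gauge \<gamma> \<and> (\<forall>p. p tagged_division_of {a..b} \<and> \<gamma> fine p \<longrightarrow>
        norm ((\<Sum>(x,K)\<in>p. measure lborel K *\<^sub>R g x) - (f b - f a)) < e)"
    proof (intro exI[of _ "\<lambda>x. \<gamma> x \<inter> ball x (d x)"] conjI allI impI)
      show "gauge (\<lambda>x. \<gamma> x \<inter> ball x (d x))"
        using \<gamma> dpos gauge_Int gauge_ball_dependent by blast
    next
      fix p assume "p tagged_division_of {a..b} \<and> (\<lambda>x. \<gamma> x \<inter> ball x (d x)) fine p"
      then have p: "p tagged_division_of {a..b}" and f1: "\<gamma> fine p"
        and f2: "(\<lambda>x. ball x (d x)) fine p"
        by (auto simp: fine_Int)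
      have piece: "norm (measure lborel K *\<^sub>R g x - (f (Sup K) - f (Inf K)))
          \<le> \<eta> * (Sup K - Inf K) + L * (measure lborel K * indicator N x)" if xK: "(x,K) \<in> p" for x K
      proof -
        obtain u v where k: "K = cbox u v" and x: "x \<in> K" and kab: "K \<subseteq> {a..b}"
          using p xK by (metis tagged_division_ofD(2-4))
        have "u \<le> v" using x k by auto
        have uv: "u \<in> K" "v \<in> K" "u \<in> {a..b}" "v \<in> {a..b}" "x \<in> {a..b}"
          using \<open>u \<le> v\<close> x kab k by auto
        have bd: "Sup K = v" "Inf K = u" "measure lborel K = v - u" using \<open>u \<le> v\<close> k by auto
        show ?thesis
        proof (cases "x \<in> N")
          case True
          have "norm (f v - f u) \<le> L * (v - u)"
            using lipschitz_onD[OF lip uv(4,3)] \<open>u \<le> v\<close> by (simp add: dist_norm)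
          moreover have "0 \<le> \<eta> * (v - u)" using \<eta> \<open>u \<le> v\<close> by simp
          ultimately show ?thesis
            using True unfolding bd by (simp add: g_def norm_minus_commute)
        next
          case False
          have ball: "norm (u - x) < d x" "norm (v - x) < d x"
            using f2 xK uv unfolding fine_def by (fastforce simp: dist_norm norm_minus_commute)+
          have "norm ((v - u) *\<^sub>R f' x - (f v - f u))
              = norm (f u - f x - (u - x) *\<^sub>R f' x - (f v - f x - (v - x) *\<^sub>R f' x))"
            by (auto simp: algebra_simps)
          also have "\<dots> \<le> norm (f u - f x - (u - x) *\<^sub>R f' x) + norm (f v - f x - (v - x) *\<^sub>R f' x)"
            by (rule norm_triangle_ineq4)
          also have "\<dots> \<le> \<eta> * norm (u - x) + \<eta> * norm (v - x)"
            using d[of x u] d[of x v] uv False ball by (intro add_mono) auto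
          also have "\<dots> = \<eta> * (v - u)"
            using x k by (auto simp: algebra_simps)
          finally show ?thesis
            using False unfolding bd by (simp add: g_def)
        qed
      qed
      have fin: "(\<Sum>(x,K)\<in>p. f (Sup K) - f (Inf K)) = f b - f a"
        "(\<Sum>(x,K)\<in>p. Sup K - Inf K) = b - a"
        using additive_tagged_division_1[OF \<open>a \<le> b\<close> p, of f]
          additive_tagged_division_1[OF \<open>a \<le> b\<close> p, of "\<lambda>x. x"] by auto
      have "norm ((\<Sum>(x,K)\<in>p. measure lborel K *\<^sub>R g x) - (f b - f a))
          = norm (\<Sum>(x,K)\<in>p. measure lborel K *\<^sub>R g x - (f (Sup K) - f (Inf K)))"
        unfolding fin(1)[symmetric] by (simp add: split_def sum_subtractf)
      also have "\<dots> \<le> (\<Sum>(x,K)\<in>p. \<eta> * (Sup K - Inf K) + L * (measure lborel K * indicator N x))"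
        by (rule sum_norm_le) (use piece in auto)
      also have "\<dots> = \<eta> * (b - a) + L * (\<Sum>(x,K)\<in>p. measure lborel K *\<^sub>R indicator N x)"
        unfolding fin(2)[symmetric] by (simp add: split_def sum.distrib sum_distrib_left)
      also have "\<dots> \<le> \<eta> * (b - a) + L * \<eta>"
        using \<gamma>N[OF p f1] L by (intro add_left_mono mult_left_mono) auto
      finally show "norm ((\<Sum>(x,K)\<in>p. measure lborel K *\<^sub>R g x) - (f b - f a)) < e"
        using \<eta>e by linarith
    qed
  qed
  then show ?thesis
    by (rule has_integral_spike[OF neg, rotated]) (auto simp: g_def)
qed

section \<open>Two facts about real functions and numbers\<close>

lemma lipschitz_on_reciprocal:
  fixes f :: "'a::metric_space \<Rightarrow> real"
  assumes "compact S" and lip: "L-lipschitz_on S f" and pos: "\<And>x. x \<in> S \<Longrightarrow> f x > 0"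
  shows "\<exists>M. M-lipschitz_on S (\<lambda>x. 1 / f x)"
proof (cases "S = {}")
  case False
  have "continuous_on S f" using lip by (rule lipschitz_on_continuous_on)
  then obtain x0 where x0: "x0 \<in> S" "\<And>x. x \<in> S \<Longrightarrow> f x0 \<le> f x"
    using continuous_attains_inf[OF \<open>compact S\<close> False] by blast
  define m where "m = f x0"
  have m: "m > 0" "\<And>x. x \<in> S \<Longrightarrow> m \<le> f x" using x0 pos by (auto simp: m_def)
  have L: "L \<ge> 0" using lip lipschitz_on_nonneg by blast
  have "(L / m\<^sup>2)-lipschitz_on S (\<lambda>x. 1 / f x)"
  proof (rule lipschitz_onI)
    fix x y assume xy: "x \<in> S" "y \<in> S"
    have p: "f x > 0" "f y > 0" using pos xy by auto
    have mm: "m\<^sup>2 \<le> f x * f y"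
      unfolding power2_eq_square using m xy p by (intro mult_mono) auto
    have "dist (1 / f x) (1 / f y) = dist (f x) (f y) / (f x * f y)"
    proof -
      have "1 / f x - 1 / f y = (f y - f x) / (f x * f y)"
        using p by (simp add: diff_divide_distrib)
      then show ?thesis
        using p by (simp add: dist_real_def abs_minus_commute)
    qed
    also have "\<dots> \<le> (L * dist x y) / m\<^sup>2"
      using lipschitz_onD[OF lip xy] m(1) mm L by (intro frac_le) auto
    finally show "dist (1 / f x) (1 / f y) \<le> L / m\<^sup>2 * dist x y" by simp
  qed (use L in simp)
  then show ?thesis by blast
qed (auto intro: exI[of _ 0])

text \<open>This turns a bound by an integrable, linear expression into the geometric mean, and so replaces
  the Cauchy--Schwarz inequality for integrals. For \<open>p, z > 0\<close> the optimal weight is \<open>\<surd>(z / p)\<close>; if one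
  of them vanishes, letting the weight tend to \<open>0\<close> or \<open>\<infinity>\<close> gives \<open>l \<le> 0\<close>.\<close>

lemma le_sqrt_mult_if_le_weighted_mean:
  fixes l p z :: real
  assumes "p \<ge> 0" "z \<ge> 0" and le: "\<And>m. m > 0 \<Longrightarrow> l \<le> (m * p + z / m) / 2"
  shows "l \<le> sqrt (p * z)"
proof -
  consider "p = 0" | "z = 0" | "p > 0" "z > 0" using assms by fastforce
  then show ?thesis
  proof cases
    case 1
    have "l \<le> e" if "e > 0" for e :: real
    proof -
      have "l \<le> z / ((z + 1) / e) / 2" using le[of "(z+1)/e"] that assms 1 by simp
      also have "\<dots> = e * (z / (z + 1)) / 2" by simp
      also have "\<dots> \<le> e * 1 / 2"
        using that assms by (intro divide_right_mono mult_left_mono) auto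
      finally show ?thesis using that by simp
    qed
    then show ?thesis using 1 field_le_epsilon[of l 0] by simp
  next
    case 2
    have "l \<le> e" if "e > 0" for e :: real
    proof -
      have "l \<le> e * (p / (p + 1)) / 2" using le[of "e / (p+1)"] that assms 2 by simp
      also have "\<dots> \<le> e * 1 / 2"
        using that assms by (intro divide_right_mono mult_left_mono) auto
      finally show ?thesis using that by simp
    qed
    then show ?thesis using 2 field_le_epsilon[of l 0] by simp
  next
    case 3
    have sq: "sqrt p * sqrt p = p" "sqrt z * sqrt z = z" using 3 by auto
    have "l \<le> (sqrt z / sqrt p * p + z / (sqrt z / sqrt p)) / 2"
      using le[of "sqrt z / sqrt p"] 3 by simp
    also have "sqrt z / sqrt p * p = sqrt p * sqrt z" using 3 sq by (simp add: field_simps)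
    also have "z / (sqrt z / sqrt p) = sqrt p * sqrt z" using 3 sq by (simp add: field_simps)
    finally show ?thesis by (simp add: real_sqrt_mult)
  qed
qed

section \<open>Flat null coordinates\<close>

lemma carrier_aff_iff: "q \<in> carrier aff \<longleftrightarrow> snd q > 0"
  by (simp add: aff_def)

text \<open>The condition \<open>K = 0\<close> reads \<open>c\<^sup>2 = a\<^sup>2\<close>. The sign \<open>s\<close> is that of \<open>\<gamma> = - c / |A|\<close>; it decides whether
  \<open>y\<close> increases or decreases towards the future.\<close>

locale flat_lorentz_structure =
  fixes A :: "real^2^2" and s :: real
  assumes det_pos: "det A > 0" and a_pos: "A$1$1 > 0"
    and s_cases: "s = 1 \<or> s = -1" and c_eq: "A$2$1 = - s * A$1$1"
begin

text \<open>The null direction \<open>v\<^sub>1 = s v\<^sub>2\<close> is spanned by the left-invariant field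
  \<open>X\<^sub>2 - k X\<^sub>1\<close>, whose integral curves are the lines \<open>x + k y = const\<close>; \<open>shear\<close> is this \<open>k\<close>, and
  \<open>null_x\<close> labels these lines. The other null direction is that of \<open>X\<^sub>1\<close>, so the second null
  coordinate is a function of \<open>y\<close> alone. Taking \<open>s (1 - 1 / y)\<close> makes the metric coefficient constant.\<close>

definition shear :: real where
  "shear = (A$1$2 - s * A$2$2) / (2 * A$1$1)"

definition null_y :: "real \<times> real \<Rightarrow> real" where
  "null_y q = s * (1 - 1 / snd q)"

definition null_x :: "real \<times> real \<Rightarrow> real" where
  "null_x q = fst q + shear * (snd q - 1)"

text \<open>The coordinate \<open>null_x\<close> is affine in \<open>x\<close> and \<open>y\<close>, so its differential has no base point.\<close>

definition d_null_y :: "real \<times> real \<Rightarrow> real \<times> real \<Rightarrow> real" where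
  "d_null_y q \<xi> = s * snd \<xi> / (snd q)\<^sup>2"

definition d_null_x :: "real \<times> real \<Rightarrow> real" where
  "d_null_x \<xi> = fst \<xi> + shear * snd \<xi>"

lemma s_square: "s * s = 1"
  using s_cases by auto

lemma det_eq: "det A = A$1$1 * (A$2$2 + s * A$1$2)"
  by (simp add: det_2 c_eq algebra_simps)

text \<open>That the factors on the right are positive gives the cone (\<open>future_nonspacelike_null\<close>); that
  their product is the constant \<open>2 |A|\<close> gives the flat metric (\<open>lorentz_form_null\<close>).\<close>

lemma null_components:
  fixes \<xi> :: "real \<times> real"
  assumes "snd q > 0"
  defines "v \<equiv> A *v left_coords q \<xi>"
  shows "v$1 + s * v$2 = det A / A$1$1 * snd q * d_null_y q \<xi>"
    and "v$1 - s * v$2 = 2 * A$1$1 / snd q * d_null_x \<xi>"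
proof -
  have v: "v$1 = A$1$1 * (fst \<xi> / snd q) + A$1$2 * (snd \<xi> / snd q)"
    "v$2 = - s * A$1$1 * (fst \<xi> / snd q) + A$2$2 * (snd \<xi> / snd q)"
    by (simp_all add: v_def left_coords_def matrix_vector_mult_def sum_2 c_eq)
  have "v$1 + s * v$2 = s * (A$2$2 + s * A$1$2) * (snd \<xi> / snd q)"
    using s_cases unfolding v by (auto simp: algebra_simps)
  then show "v$1 + s * v$2 = det A / A$1$1 * snd q * d_null_y q \<xi>"
    using assms(1) a_pos by (simp add: d_null_y_def det_eq power2_eq_square)
  have "v$1 - s * v$2 = 2 * A$1$1 * (fst \<xi> / snd q) + (A$1$2 - s * A$2$2) * (snd \<xi> / snd q)"
    using s_cases unfolding v by (auto simp: algebra_simps)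
  also have "\<dots> = 2 * A$1$1 / snd q * d_null_x \<xi>"
    using assms(1) a_pos by (simp add: d_null_x_def shear_def field_simps)
  finally show "v$1 - s * v$2 = 2 * A$1$1 / snd q * d_null_x \<xi>" .
qed

lemma lorentz_form_null:
  assumes "snd q > 0"
  shows "- lorentz_form A (left_coords q \<xi>) (left_coords q \<xi>) = 2 * det A * d_null_y q \<xi> * d_null_x \<xi>"
proof -
  let ?v = "A *v left_coords q \<xi>"
  have "- lorentz_form A (left_coords q \<xi>) (left_coords q \<xi>)
      = (?v$1 + s * ?v$2) * (?v$1 - s * ?v$2)"
    using s_cases by (auto simp: lorentz_form_def algebra_simps)
  also have "\<dots> = 2 * det A * d_null_y q \<xi> * d_null_x \<xi>"
    unfolding null_components[OF assms] using assms a_pos by (simp add: field_simps)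
  finally show ?thesis .
qed

lemma future_nonspacelike_null:
  assumes "snd q > 0"
  shows "future_nonspacelike A (left_coords q \<xi>) \<longleftrightarrow> d_null_y q \<xi> \<ge> 0 \<and> d_null_x \<xi> \<ge> 0"
proof -
  let ?v = "A *v left_coords q \<xi>"
  have "future_nonspacelike A (left_coords q \<xi>)
      \<longleftrightarrow> ?v$1 + s * ?v$2 \<ge> 0 \<and> ?v$1 - s * ?v$2 \<ge> 0"
    using s_cases by (auto simp: future_nonspacelike_def)
  also have "\<dots> \<longleftrightarrow> d_null_y q \<xi> \<ge> 0 \<and> d_null_x \<xi> \<ge> 0"
  proof -
    have pos: "det A / A$1$1 * snd q > 0" "2 * A$1$1 / snd q > 0"
      using assms a_pos det_pos by simp_all
    have "0 \<le> k * x \<longleftrightarrow> 0 \<le> x" if "k > 0" for k x :: real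
      using that by (simp add: zero_le_mult_iff)
    then show ?thesis
      unfolding null_components[OF assms] using pos by presburger
  qed
  finally show ?thesis .
qed

lemma null_coordinates_derivative:
  assumes "(c has_vector_derivative \<xi>) (at t within S)" and "snd (c t) > 0"
  shows "((\<lambda>t. null_y (c t)) has_vector_derivative d_null_y (c t) \<xi>) (at t within S)"
    and "((\<lambda>t. null_x (c t)) has_vector_derivative d_null_x \<xi>) (at t within S)"
proof -
  have 1: "((\<lambda>t. fst (c t)) has_real_derivative fst \<xi>) (at t within S)"
    "((\<lambda>t. snd (c t)) has_real_derivative snd \<xi>) (at t within S)"
    using bounded_linear.has_vector_derivative[OF bounded_linear_fst assms(1)]
      bounded_linear.has_vector_derivative[OF bounded_linear_snd assms(1)]
    by (simp_all add: has_real_derivative_iff_has_vector_derivative)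
  show "((\<lambda>t. null_y (c t)) has_vector_derivative d_null_y (c t) \<xi>) (at t within S)"
    unfolding null_y_def d_null_y_def has_real_derivative_iff_has_vector_derivative[symmetric]
    using assms(2) by (auto intro!: derivative_eq_intros 1 simp: power2_eq_square)
  show "((\<lambda>t. null_x (c t)) has_vector_derivative d_null_x \<xi>) (at t within S)"
    unfolding null_x_def d_null_x_def has_real_derivative_iff_has_vector_derivative[symmetric]
    by (auto intro!: derivative_eq_intros 1)
qed

section \<open>Nonspacelike curves are no longer than segments\<close>

lemma lipschitz_null_coordinates:
  fixes t0 t1 :: real
  assumes "C-lipschitz_on {t0..t1} c" and "c ` {t0..t1} \<subseteq> carrier aff"
  shows "\<exists>L. L-lipschitz_on {t0..t1} (\<lambda>t. null_y (c t))"
    and "\<exists>L. L-lipschitz_on {t0..t1} (\<lambda>t. null_x (c t))"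
proof -
  have f: "1-lipschitz_on X (fst :: real \<times> real \<Rightarrow> real)" for X
    by (rule lipschitz_onI) (auto simp: dist_fst_le)
  have g: "1-lipschitz_on X (snd :: real \<times> real \<Rightarrow> real)" for X
    by (rule lipschitz_onI) (auto simp: dist_snd_le)
  have x: "(1 * C)-lipschitz_on {t0..t1} (\<lambda>t. fst (c t))"
    using lipschitz_on_compose2[OF assms(1) f] .
  have y: "(1 * C)-lipschitz_on {t0..t1} (\<lambda>t. snd (c t))"
    using lipschitz_on_compose2[OF assms(1) g] .
  have "snd (c t) > 0" if "t \<in> {t0..t1}" for t
    using assms(2) that by (auto simp: carrier_aff_iff[symmetric])
  then obtain M where M: "M-lipschitz_on {t0..t1} (\<lambda>t. 1 / snd (c t))"
    using lipschitz_on_reciprocal[OF compact_Icc y] by blast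
  show "\<exists>L. L-lipschitz_on {t0..t1} (\<lambda>t. null_y (c t))"
    unfolding null_y_def
    by (rule exI, (rule M lipschitz_on_constant lipschitz_on_diff lipschitz_on_cmult_real)+)
  show "\<exists>L. L-lipschitz_on {t0..t1} (\<lambda>t. null_x (c t))"
    unfolding null_x_def
    by (rule exI, (rule x y lipschitz_on_constant lipschitz_on_add lipschitz_on_diff lipschitz_on_cmult_real)+)
qed

text \<open>The functions \<open>p\<close> and \<open>z\<close> are the derivatives of the null coordinates along the curve where they
  exist. Only these three properties enter the estimates that follow.\<close>

lemma nonspacelike_curve_null_derivatives:
  assumes "nonspacelike_curve A t0 t1 c"
  obtains N p z where "negligible N"
    and "(p has_integral (null_y (c t1) - null_y (c t0))) {t0..t1}"
    and "(z has_integral (null_x (c t1) - null_x (c t0))) {t0..t1}"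
    and "\<And>t. t \<in> {t0..t1} - N \<Longrightarrow> p t \<ge> 0 \<and> z t \<ge> 0 \<and>
      - lorentz_form A (velocity t0 t1 c t) (velocity t0 t1 c t) = 2 * det A * p t * z t"
proof -
  from assms obtain C where le: "t0 \<le> t1" and im: "c ` {t0..t1} \<subseteq> carrier aff"
    and C: "C-lipschitz_on {t0..t1} c"
    and ae: "AE t\<in>{t0..t1} in lebesgue. c differentiable (at t within {t0..t1}) \<and>
        future_nonspacelike A (velocity t0 t1 c t)"
    unfolding nonspacelike_curve_def by auto
  obtain N where N: "negligible N"
    and off: "\<And>t. t \<in> {t0..t1} - N \<Longrightarrow> c differentiable (at t within {t0..t1}) \<and>
        future_nonspacelike A (velocity t0 t1 c t)"
    using ae unfolding eventually_ae_filter negligible_iff_null_sets by auto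
  define \<xi> where "\<xi> t = vector_derivative c (at t within {t0..t1})" for t
  have y: "snd (c t) > 0" if "t \<in> {t0..t1}" for t
    using im that by (auto simp: carrier_aff_iff[symmetric])
  have der: "(c has_vector_derivative \<xi> t) (at t within {t0..t1})" if "t \<in> {t0..t1} - N" for t
    using off[OF that] unfolding \<xi>_def by (simp add: vector_derivative_works)
  obtain L M where L: "L-lipschitz_on {t0..t1} (\<lambda>t. null_y (c t))"
    and M: "M-lipschitz_on {t0..t1} (\<lambda>t. null_x (c t))"
    using lipschitz_null_coordinates[OF C im] by blast
  show thesis
  proof
    show "negligible N" by fact
    show "((\<lambda>t. d_null_y (c t) (\<xi> t)) has_integral (null_y (c t1) - null_y (c t0))) {t0..t1}"
      using null_coordinates_derivative(1)[OF der] y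
      by (intro fundamental_theorem_of_calculus_lipschitz[OF le L N]) auto
    show "((\<lambda>t. d_null_x (\<xi> t)) has_integral (null_x (c t1) - null_x (c t0))) {t0..t1}"
      using null_coordinates_derivative(2)[OF der] y
      by (intro fundamental_theorem_of_calculus_lipschitz[OF le M N]) auto
    show "d_null_y (c t) (\<xi> t) \<ge> 0 \<and> d_null_x (\<xi> t) \<ge> 0 \<and>
      - lorentz_form A (velocity t0 t1 c t) (velocity t0 t1 c t) = 2 * det A * d_null_y (c t) (\<xi> t) * d_null_x (\<xi> t)"
      if "t \<in> {t0..t1} - N" for t
      using off[OF that] that y[of t] unfolding velocity_def \<xi>_def[symmetric]
      by (auto simp: future_nonspacelike_null lorentz_form_null)
  qed
qed

lemma null_coordinates_mono:
  assumes "nonspacelike_curve A t0 t1 c"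
  shows "null_y (c t0) \<le> null_y (c t1)" and "null_x (c t0) \<le> null_x (c t1)"
proof -
  obtain N p z where N: "negligible N"
    and p: "(p has_integral (null_y (c t1) - null_y (c t0))) {t0..t1}"
    and z: "(z has_integral (null_x (c t1) - null_x (c t0))) {t0..t1}"
    and off: "\<And>t. t \<in> {t0..t1} - N \<Longrightarrow> p t \<ge> 0 \<and> z t \<ge> 0"
    using nonspacelike_curve_null_derivatives[OF assms] by metis
  \<comment> \<open>Changing the integrand on the null set makes it nonnegative everywhere.\<close>
  have p': "((\<lambda>t. \<bar>p t\<bar>) has_integral (null_y (c t1) - null_y (c t0))) {t0..t1}"
    using off by (intro has_integral_spike[OF N _ p]) auto
  show "null_y (c t0) \<le> null_y (c t1)"
    using has_integral_nonneg[OF p'] by simp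
  have z': "((\<lambda>t. \<bar>z t\<bar>) has_integral (null_x (c t1) - null_x (c t0))) {t0..t1}"
    using off by (intro has_integral_spike[OF N _ z]) auto
  show "null_x (c t0) \<le> null_x (c t1)"
    using has_integral_nonneg[OF z'] by simp
qed

text \<open>For each weight \<open>m > 0\<close> the length element \<open>\<surd>(2 |A| p z)\<close> is at most \<open>(2 |A| m p + z / m) / 2\<close>, the
  integral of which is known from the endpoints. Thus the length is bounded by all weighted
  means, and hence by their infimum.\<close>

lemma lorentz_length_le:
  assumes "nonspacelike_curve A t0 t1 c"
  shows "lorentz_length A t0 t1 c \<le> sqrt (2 * det A * (null_y (c t1) - null_y (c t0)) * (null_x (c t1) - null_x (c t0)))"
proof -
  define F where "F t = sqrt (- lorentz_form A (velocity t0 t1 c t) (velocity t0 t1 c t))" for t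
  define K where "K = 2 * det A"
  have K: "K > 0" using det_pos by (simp add: K_def)
  obtain N p z where N: "negligible N"
    and p: "(p has_integral (null_y (c t1) - null_y (c t0))) {t0..t1}"
    and z: "(z has_integral (null_x (c t1) - null_x (c t0))) {t0..t1}"
    and off: "\<And>t. t \<in> {t0..t1} - N \<Longrightarrow> p t \<ge> 0 \<and> z t \<ge> 0 \<and> F t = sqrt (K * p t * z t)"
    using nonspacelike_curve_null_derivatives[OF assms] unfolding F_def K_def by metis
  have mono: "0 \<le> null_y (c t1) - null_y (c t0)" "0 \<le> null_x (c t1) - null_x (c t0)"
    using null_coordinates_mono[OF assms] by auto
  show ?thesis
  proof (cases "F integrable_on {t0..t1}")
    case False
    then have "lorentz_length A t0 t1 c = 0"
      unfolding lorentz_length_def F_def by (rule not_integrable_integral)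
    then show ?thesis using mono K unfolding K_def by simp
  next
    case True
    then have F: "(F has_integral lorentz_length A t0 t1 c) {t0..t1}"
      unfolding lorentz_length_def F_def by (rule integrable_integral)
    have "lorentz_length A t0 t1 c \<le> (m * (K * (null_y (c t1) - null_y (c t0))) + (null_x (c t1) - null_x (c t0)) / m) / 2"
      if m: "m > 0" for m
    proof -
      let ?G = "\<lambda>t. (m * (K * p t) + z t / m) / 2"
      have "F t \<le> ?G t" if "t \<in> {t0..t1} - N" for t
      proof -
        have "F t = sqrt ((m * (K * p t)) * (z t / m))" using off[OF that] m by simp
        also have "\<dots> \<le> ?G t"
          using off[OF that] m K by (intro arith_geo_mean_sqrt) auto
        finally show ?thesis .
      qed
      moreover have "(?G has_integral (m * (K * (null_y (c t1) - null_y (c t0))) + (null_x (c t1) - null_x (c t0)) / m) / 2)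
          {t0..t1}"
        by (intro has_integral_divide has_integral_add has_integral_mult_right p z)
      then have "((\<lambda>t. if t \<in> N then F t else ?G t) has_integral
          (m * (K * (null_y (c t1) - null_y (c t0))) + (null_x (c t1) - null_x (c t0)) / m) / 2) {t0..t1}"
        by (rule has_integral_spike[OF N, rotated]) auto
      ultimately show ?thesis
        by (intro has_integral_le[OF F]) auto
    qed
    then show ?thesis
      using le_sqrt_mult_if_le_weighted_mean[of "K * (null_y (c t1) - null_y (c t0))"] mono K
      unfolding K_def by simp
  qed
qed

section \<open>Segments in null coordinates\<close>

text \<open>The curve is the affine segment in null coordinates. Its reciprocal second coordinate \<open>r = 1 / y\<close>
  interpolates affinely between two positive numbers, so the curve never leaves \<open>G\<close>. Its velocity
  is constant in null coordinates, and the length element is constant.\<close>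

lemma segment_curve:
  assumes q: "q0 \<in> carrier aff" "q1 \<in> carrier aff" and "null_y q0 \<le> null_y q1" "null_x q0 \<le> null_x q1"
  shows "\<exists>c. nonspacelike_curve A 0 1 c \<and> c 0 = q0 \<and> c 1 = q1 \<and>
    lorentz_length A 0 1 c = sqrt (2 * det A * (null_y q1 - null_y q0) * (null_x q1 - null_x q0))"
proof -
  have pos: "snd q0 > 0" "snd q1 > 0" using q by (auto simp: aff_def)
  define r where "r t = 1 / snd q0 + (1 / snd q1 - 1 / snd q0) * t" for t :: real
  define y where "y t = 1 / r t" for t
  define x where "x t = null_x q0 + (null_x q1 - null_x q0) * t - shear * (y t - 1)" for t :: real
  define c where "c t = (x t, y t)" for t
  define dy where "dy t = (1 / snd q0 - 1 / snd q1) / (r t)\<^sup>2" for t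
  define \<xi> where "\<xi> t = (null_x q1 - null_x q0 - shear * dy t, dy t)" for t
  have r: "r t > 0" if "t \<in> {0..1}" for t
  proof (cases "t = 0")
    case False
    then have "t * (1 / snd q1) > 0" using that pos by simp
    moreover have "(1 - t) * (1 / snd q0) \<ge> 0" using that pos by simp
    ultimately have "(1 - t) * (1 / snd q0) + t * (1 / snd q1) > 0" by linarith
    also have "(1 - t) * (1 / snd q0) + t * (1 / snd q1) = r t"
      by (simp add: r_def algebra_simps diff_divide_distrib)
    finally show ?thesis .
  qed (use pos in \<open>simp add: r_def\<close>)
  have der: "(c has_vector_derivative \<xi> t) (at t within {0..1})" if t: "t \<in> {0..1}" for t
  proof -
    have dr: "(r has_real_derivative (1 / snd q1 - 1 / snd q0)) (at t within {0..1})"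
      unfolding r_def by (auto intro!: derivative_eq_intros)
    have dy: "(y has_real_derivative dy t) (at t within {0..1})"
      using r[OF t] pos unfolding dy_def y_def
      by (auto intro!: derivative_eq_intros dr simp: power2_eq_square diff_divide_distrib)
    have "(x has_real_derivative (null_x q1 - null_x q0 - shear * dy t)) (at t within {0..1})"
      unfolding x_def by (auto intro!: derivative_eq_intros dy)
    then show ?thesis
      using dy unfolding c_def \<xi>_def has_real_derivative_iff_has_vector_derivative
      by (rule has_vector_derivative_Pair)
  qed
  have vel: "velocity 0 1 c t = left_coords (c t) (\<xi> t)" if "t \<in> {0..1}" for t
    unfolding velocity_def using vector_derivative_within_closed_interval[OF _ that der[OF that]] by simp
  have d_null_y: "d_null_y (c t) (\<xi> t) = null_y q1 - null_y q0" if "t \<in> {0..1}" for t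
  proof -
    have "d_null_y (c t) (\<xi> t) = s * (dy t * (r t)\<^sup>2)"
      by (simp add: d_null_y_def c_def y_def \<xi>_def power_divide)
    also have "dy t * (r t)\<^sup>2 = 1 / snd q0 - 1 / snd q1"
      using r[OF that] by (simp add: dy_def)
    finally show ?thesis by (simp add: null_y_def algebra_simps)
  qed
  have d_null_x: "d_null_x (\<xi> t) = null_x q1 - null_x q0" for t
    by (simp add: d_null_x_def \<xi>_def)
  have snd_c: "snd (c t) > 0" if "t \<in> {0..1}" for t
    using r[OF that] by (simp add: c_def y_def)
  have "\<exists>L. L-lipschitz_on {0..1} c"
  proof -
    have "\<exists>L. L-lipschitz_on {0..1} r"
      unfolding r_def
      by (rule exI, (rule lipschitz_on_constant lipschitz_on_id lipschitz_on_add lipschitz_on_cmult_real)+)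
    then obtain M where M: "M-lipschitz_on {0..1} y"
      unfolding y_def[abs_def]
      using lipschitz_on_reciprocal[OF compact_Icc, of _ 0 1 r] r by blast
    show ?thesis
      unfolding c_def[abs_def] x_def
      by (rule exI, (rule M lipschitz_on_constant lipschitz_on_id lipschitz_on_Pair
          lipschitz_on_add lipschitz_on_diff lipschitz_on_cmult_real)+)
  qed
  moreover have "c differentiable (at t within {0..1})" if "t \<in> {0..1}" for t
    using der[OF that] by (rule differentiableI_vector)
  moreover have "future_nonspacelike A (velocity 0 1 c t)" if "t \<in> {0..1}" for t
    unfolding vel[OF that] using assms(3,4) d_null_y[OF that] d_null_x snd_c[OF that]
    by (simp add: future_nonspacelike_null)
  ultimately have "nonspacelike_curve A 0 1 c"
    using snd_c unfolding nonspacelike_curve_def by (auto simp: carrier_aff_iff)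
  moreover have "c 0 = q0" "c 1 = q1"
    using pos by (auto simp: c_def x_def y_def r_def null_x_def prod_eq_iff)
  moreover have "lorentz_length A 0 1 c = sqrt (2 * det A * (null_y q1 - null_y q0) * (null_x q1 - null_x q0))"
  proof -
    have "lorentz_length A 0 1 c
        = integral {0..1} (\<lambda>t::real. sqrt (2 * det A * (null_y q1 - null_y q0) * (null_x q1 - null_x q0)))"
      unfolding lorentz_length_def using snd_c
      by (intro integral_cong) (simp add: vel lorentz_form_null d_null_y d_null_x)
    then show ?thesis by simp
  qed
  ultimately show ?thesis by blast
qed

text \<open>The supremum that defines the distance is a maximum, attained by the segment.\<close>

theorem lorentz_dist_eq:
  assumes "q0 \<in> carrier aff" "q1 \<in> carrier aff"
  shows "lorentz_dist A q0 q1 = (if null_y q0 \<le> null_y q1 \<and> null_x q0 \<le> null_x q1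
    then ereal (sqrt (2 * det A * (null_y q1 - null_y q0) * (null_x q1 - null_x q0))) else 0)"
proof (cases "null_y q0 \<le> null_y q1 \<and> null_x q0 \<le> null_x q1")
  case True
  let ?l = "sqrt (2 * det A * (null_y q1 - null_y q0) * (null_x q1 - null_x q0))"
  obtain c where "nonspacelike_curve A 0 1 c" "c 0 = q0" "c 1 = q1" "lorentz_length A 0 1 c = ?l"
    using segment_curve[OF assms] True by blast
  then have l: "?l \<in> lengths A q0 q1"
    unfolding lengths_def mem_Collect_eq by metis
  have "Sup (ereal ` lengths A q0 q1) = ereal ?l"
  proof (rule Sup_eqI)
    show "x \<le> ereal ?l" if "x \<in> ereal ` lengths A q0 q1" for x
      using that lorentz_length_le unfolding lengths_def by fastforce
  qed (use l in auto)
  then show ?thesis using True l unfolding lorentz_dist_def by auto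
next
  case False
  then have "lengths A q0 q1 = {}"
    using null_coordinates_mono unfolding lengths_def by blast
  then show ?thesis unfolding if_not_P[OF False] lorentz_dist_def by simp
qed

section \<open>The future of the identity\<close>

lemma identity_origin: "null_y \<one>\<^bsub>aff\<^esub> = 0" "null_x \<one>\<^bsub>aff\<^esub> = 0" "\<one>\<^bsub>aff\<^esub> \<in> carrier aff"
  by (simp_all add: null_y_def null_x_def aff_def)

lemma causal_future_eq: "causal_future A = {q \<in> carrier aff. null_y q \<ge> 0 \<and> null_x q \<ge> 0}"
proof (intro subset_antisym subsetI)
  fix q assume "q \<in> causal_future A"
  then obtain t0 t1 c where c: "nonspacelike_curve A t0 t1 c" "c t0 = \<one>\<^bsub>aff\<^esub>" "c t1 = q"
    unfolding causal_future_def by auto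
  then have "q \<in> carrier aff" unfolding nonspacelike_curve_def by auto
  then show "q \<in> {q \<in> carrier aff. null_y q \<ge> 0 \<and> null_x q \<ge> 0}"
    using null_coordinates_mono[OF c(1)] unfolding c(2,3) identity_origin by simp
next
  fix q assume "q \<in> {q \<in> carrier aff. null_y q \<ge> 0 \<and> null_x q \<ge> 0}"
  then show "q \<in> causal_future A"
    using segment_curve[OF identity_origin(3), of q] unfolding identity_origin causal_future_def
    by blast
qed

lemma null_y_sign: "snd q > 0 \<Longrightarrow> null_y q \<ge> 0 \<longleftrightarrow> s * (snd q - 1) \<ge> 0"
  "snd q > 0 \<Longrightarrow> null_y q > 0 \<longleftrightarrow> s * (snd q - 1) > 0"
  using s_cases by (auto simp: null_y_def)

text \<open>In terms of \<open>null_x\<close> and \<open>s (y - 1)\<close>, which has the sign of \<open>null_y\<close> and is defined for all \<open>y\<close>,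
  both quadrants are given by inequalities between affine functions. An interior point
  can be pushed a little in the direction that decreases both functions at unit rate and still lies
  in the closed quadrant, so both were positive.\<close>

lemma interior_causal_future:
  "top_of_set (carrier aff) interior_of causal_future A = {q \<in> carrier aff. null_y q > 0 \<and> null_x q > 0}"
    (is "_ = ?O")
proof (intro subset_antisym subsetI)
  fix q assume "q \<in> top_of_set (carrier aff) interior_of causal_future A"
  then obtain T where T: "open T" "q \<in> T" "carrier aff \<inter> T \<subseteq> causal_future A" and q: "q \<in> carrier aff"
    unfolding interior_of_def by (auto simp: openin_open)
  define c where "c \<epsilon> = q + \<epsilon> *\<^sub>R (shear * s - 1, - s)" for \<epsilon>
  have "(c \<longlongrightarrow> c 0) (at_right 0)"
    unfolding c_def by (intro tendsto_intros)
  moreover have "open (T \<inter> {q. snd q > 0})"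
    by (intro open_Int T open_Collect_less continuous_intros)
  moreover have "c 0 = q" by (simp add: c_def prod_eq_iff)
  then have "c 0 \<in> T \<inter> {q. snd q > 0}"
    using T q by (simp add: carrier_aff_iff)
  ultimately have "\<forall>\<^sub>F \<epsilon> in at_right 0. c \<epsilon> \<in> T \<inter> {q. snd q > 0}"
    by (rule topological_tendstoD)
  then have "\<forall>\<^sub>F \<epsilon> in at_right 0. c \<epsilon> \<in> T \<inter> {q. snd q > 0} \<and> \<epsilon> > 0"
    using eventually_at_right_less by (rule eventually_conj)
  then obtain \<epsilon> where "c \<epsilon> \<in> T \<inter> {q. snd q > 0}" and \<epsilon>: "\<epsilon> > 0"
    using eventually_happens' trivial_limit_at_right_real by blast
  then have "c \<epsilon> \<in> causal_future A" and y: "snd (c \<epsilon>) > 0"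
    using T(3) by (auto simp: aff_def)
  then have "s * (snd (c \<epsilon>) - 1) \<ge> 0" "null_x (c \<epsilon>) \<ge> 0"
    unfolding causal_future_eq using null_y_sign(1) by auto
  moreover have "s * (snd (c \<epsilon>) - 1) = s * (snd q - 1) - \<epsilon>" "null_x (c \<epsilon>) = null_x q - \<epsilon>"
    using s_square by (simp_all add: c_def null_x_def algebra_simps)
  ultimately have "s * (snd q - 1) > 0" "null_x q > 0" using \<epsilon> by auto
  then show "q \<in> ?O" using q null_y_sign(2)[of q] by (auto simp: aff_def)
next
  fix q assume q: "q \<in> ?O"
  let ?U = "{q :: real \<times> real. 0 < snd q} \<inter> {q. 0 < s * (snd q - 1)} \<inter> {q. 0 < null_x q}"
  have "open ?U"
    unfolding null_x_def by (intro open_Int open_Collect_less continuous_intros)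
  moreover have "?O = carrier aff \<inter> ?U"
    using null_y_sign(2) by (auto simp: aff_def)
  ultimately have "openin (top_of_set (carrier aff)) ?O"
    unfolding openin_open by blast
  moreover have "?O \<subseteq> causal_future A"
    unfolding causal_future_eq by auto
  ultimately show "q \<in> top_of_set (carrier aff) interior_of causal_future A"
    using q interior_of_maximal by blast
qed

lemma lorentz_dist_interior:
  assumes "q \<in> top_of_set (carrier aff) interior_of causal_future A"
  shows "lorentz_dist A \<one>\<^bsub>aff\<^esub> q = ereal (sqrt (2 * det A * null_y q * null_x q))"
  using assms unfolding interior_causal_future
  by (auto simp: lorentz_dist_eq identity_origin)

lemma lorentz_dist_not_interior:
  assumes "q \<in> carrier aff" "q \<notin> top_of_set (carrier aff) interior_of causal_future A"
  shows "lorentz_dist A \<one>\<^bsub>aff\<^esub> q = 0"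
  using assms unfolding interior_causal_future
  by (auto simp: lorentz_dist_eq identity_origin)

lemma lorentz_dist_image_interior:
  "lorentz_dist A \<one>\<^bsub>aff\<^esub> ` (top_of_set (carrier aff) interior_of causal_future A) = {0<..<\<infinity>}"
proof (intro subset_antisym subsetI)
  fix l assume "l \<in> lorentz_dist A \<one>\<^bsub>aff\<^esub> ` (top_of_set (carrier aff) interior_of causal_future A)"
  then obtain q where "l = ereal (sqrt (2 * det A * null_y q * null_x q))" "null_y q > 0" "null_x q > 0"
    using lorentz_dist_interior interior_causal_future by force
  then show "l \<in> {0<..<\<infinity>}" using det_pos by simp
next
  fix l :: ereal assume "l \<in> {0<..<\<infinity>}"
  then obtain r where l: "l = ereal r" and r: "r > 0" by (cases l) auto
  \<comment> \<open>Any \<open>y\<close> with \<open>s (y - 1) > 0\<close> serves; \<open>null_x\<close> is then adjusted to produce the value \<open>r\<close>.\<close>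
  define y where "y = (if s = 1 then 2 else 1 / 2 :: real)"
  define p where "p = s * (1 - 1 / y)"
  have y: "y > 0" and p: "p > 0" using s_cases by (auto simp: y_def p_def)
  define q where "q = (r\<^sup>2 / (2 * det A * p) - shear * (y - 1), y)"
  have null_q: "null_y q = p" "null_x q = r\<^sup>2 / (2 * det A * p)"
    by (simp_all add: null_y_def null_x_def q_def p_def)
  have int: "q \<in> top_of_set (carrier aff) interior_of causal_future A"
    using y p r det_pos unfolding interior_causal_future
    by (simp add: null_q) (simp add: aff_def q_def)
  have "2 * det A * null_y q * null_x q = r\<^sup>2"
    using p det_pos by (simp add: null_q)
  then have "lorentz_dist A \<one>\<^bsub>aff\<^esub> q = l"
    using lorentz_dist_interior[OF int] r l by simp
  then show "l \<in> lorentz_dist A \<one>\<^bsub>aff\<^esub> ` (top_of_set (carrier aff) interior_of causal_future A)"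
    using int by blast
qed

end

section \<open>The closed formula\<close>

lemma matrix_inv_2:
  fixes A :: "real^2^2"
  assumes "det A \<noteq> 0"
  shows "matrix_inv A $ 1 $ 1 = A$2$2 / det A" "matrix_inv A $ 1 $ 2 = - A$1$2 / det A"
    "matrix_inv A $ 2 $ 1 = - A$2$1 / det A" "matrix_inv A $ 2 $ 2 = A$1$1 / det A"
proof -
  define B where "B = matrix_inv A"
  have "\<exists>B. A ** B = mat 1 \<and> B ** A = mat 1"
    using assms invertible_det_nz[of A] by (simp add: invertible_def)
  then have AB: "A ** B = mat 1"
    unfolding B_def matrix_inv_def by (rule someI2_ex) simp
  have e: "(A ** B) $ i $ j = A$i$1 * B$1$j + A$i$2 * B$2$j" for i j
    by (simp add: matrix_matrix_mult_def sum_2)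
  have e11: "A$1$1 * B$1$1 + A$1$2 * B$2$1 = 1" and e12: "A$1$1 * B$1$2 + A$1$2 * B$2$2 = 0"
    and e21: "A$2$1 * B$1$1 + A$2$2 * B$2$1 = 0" and e22: "A$2$1 * B$1$2 + A$2$2 * B$2$2 = 1"
    unfolding e[symmetric] AB by (simp_all add: mat_def)
  have "det A * B$1$1 = A$2$2" "det A * B$1$2 = - A$1$2"
    "det A * B$2$1 = - A$2$1" "det A * B$2$2 = A$1$1"
    unfolding det_2 using e11 e12 e21 e22 by algebra+
  then show "matrix_inv A $ 1 $ 1 = A$2$2 / det A" "matrix_inv A $ 1 $ 2 = - A$1$2 / det A"
    "matrix_inv A $ 2 $ 1 = - A$2$1 / det A" "matrix_inv A $ 2 $ 2 = A$1$1 / det A"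
    using assms unfolding B_def[symmetric] by (simp_all add: field_simps)
qed

theorem theorem16:
  fixes A :: "real^2^2" and x1 y1 :: real
  assumes "det A > 0" and "A$1$1 \<ge> 0" and "sectional_curvature A = 0"
    and "(x1, y1) \<in> carrier aff"
  shows
    "((x1, y1) \<notin> causal_future A \<longrightarrow> lorentz_dist A \<one>\<^bsub>aff\<^esub> (x1, y1) = 0) \<and>
     ((x1, y1) \<in> top_of_set (carrier aff) frontier_of causal_future A \<longrightarrow>
        lorentz_dist A \<one>\<^bsub>aff\<^esub> (x1, y1) = 0) \<and>
     ((x1, y1) \<in> top_of_set (carrier aff) interior_of causal_future A \<longrightarrow>
        (let \<alpha> = matrix_inv A $ 1 $ 1; \<beta> = matrix_inv A $ 1 $ 2; \<gamma> = matrix_inv A $ 2 $ 1;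
             s1 = sgn \<gamma>;
             f = - (\<alpha> - s1 * \<beta>) / (2 * \<gamma>);
             g = - (\<alpha> + s1 * \<beta>) / (2 * \<gamma>);
             w = (x1 - g * (1 - y1)) / f;
             \<tau> = sqrt (w / (y1 - y1\<^sup>2));
             \<rho> = sqrt (w * y1 / (1 - y1))
         in lorentz_dist A \<one>\<^bsub>aff\<^esub> (x1, y1) = ereal ((\<rho> - \<tau>) / \<gamma>))) \<and>
     lorentz_dist A \<one>\<^bsub>aff\<^esub> ` (top_of_set (carrier aff) interior_of causal_future A) = {0<..<\<infinity>}"
proof -
  have "(A$2$1)\<^sup>2 = (A$1$1)\<^sup>2"
    using assms(1,3) by (simp add: sectional_curvature_eq)
  then have "A$2$1 = A$1$1 \<or> A$2$1 = - A$1$1" by (simp add: power2_eq_iff)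
  moreover have "A$1$1 \<noteq> 0"
    using assms(1) calculation by (auto simp: det_2)
  then have a: "A$1$1 > 0" using assms(2) by simp
  define s where "s = - sgn (A$2$1)"
  interpret flat_lorentz_structure A s
    by unfold_locales (use assms(1) a calculation in \<open>auto simp: s_def sgn_if\<close>)
  let ?\<gamma> = "matrix_inv A $ 2 $ 1"
  let ?\<alpha> = "matrix_inv A $ 1 $ 1" and ?\<beta> = "matrix_inv A $ 1 $ 2"
  have \<gamma>: "?\<gamma> = s * A$1$1 / det A"
    using matrix_inv_2(3)[of A] det_pos c_eq by simp
  then have sgn\<gamma>: "sgn ?\<gamma> = s"
    using det_pos a s_cases by (auto simp: sgn_mult sgn_divide)
  have f: "- (?\<alpha> - s * ?\<beta>) / (2 * ?\<gamma>) = - s * det A / (2 * (A$1$1)\<^sup>2)"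
  proof -
    have "A$2$2 + s * A$1$2 \<noteq> 0" using det_pos det_eq by auto
    moreover have "?\<alpha> - s * ?\<beta> = (A$2$2 + s * A$1$2) / det A"
      using det_pos by (simp add: matrix_inv_2 add_divide_distrib)
    ultimately have "?\<alpha> - s * ?\<beta> = 1 / A$1$1"
      by (simp add: det_eq)
    then show ?thesis
      using det_pos a s_cases by (auto simp: \<gamma> power2_eq_square)
  qed
  have g: "- (?\<alpha> + s * ?\<beta>) / (2 * ?\<gamma>) = shear"
    using det_pos a s_cases by (auto simp: \<gamma> matrix_inv_2 shear_def field_simps)
  \<comment> \<open>With \<open>M = \<tau>\<^sup>2\<close> one has \<open>\<rho> = y\<^sub>1 \<tau>\<close>, so that \<open>\<rho> - \<tau> = (y\<^sub>1 - 1) \<surd>M\<close>; here \<open>y\<^sub>1 - 1\<close> has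
    the sign of \<open>\<gamma>\<close>, and the quotient can be moved under the root.\<close>
  have formula: "(sqrt (w * y1 / (1 - y1)) - sqrt (w / (y1 - y1\<^sup>2))) / ?\<gamma>
      = sqrt (2 * det A * null_y (x1, y1) * null_x (x1, y1))"
    if w: "w = (x1 - shear * (1 - y1)) / (- s * det A / (2 * (A$1$1)\<^sup>2))"
      and pos: "null_y (x1, y1) > 0" "null_x (x1, y1) > 0" for w
  proof -
    have y: "y1 > 0" using assms(4) by (simp add: aff_def)
    define p z M where "p = null_y (x1, y1)" and "z = null_x (x1, y1)" and "M = w / (y1 - y1\<^sup>2)"
    have y1: "y1 - 1 = s * y1 * p"
      using y s_cases by (auto simp: p_def null_y_def field_simps)
    have "x1 - shear * (1 - y1) = z"
      by (simp add: z_def null_x_def algebra_simps)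
    then have wz: "w = - s * (2 * (A$1$1)\<^sup>2 * z / det A)"
      using s_cases unfolding w by (auto simp: mult.commute)
    have yy: "y1 - y1\<^sup>2 = y1 * (1 - y1)"
      by (simp add: power2_eq_square algebra_simps)
    also have "1 - y1 = - s * y1 * p" using y1 by simp
    finally have "y1 - y1\<^sup>2 = - s * (y1\<^sup>2 * p)"
      by (simp add: power2_eq_square)
    then have M: "M = 2 * (A$1$1)\<^sup>2 * z / (det A * y1\<^sup>2 * p)"
      using s_cases unfolding M_def wz by auto
    have "w * y1 / (1 - y1) = y1\<^sup>2 * M"
      using y unfolding M_def yy by (simp add: power2_eq_square)
    then have "(sqrt (w * y1 / (1 - y1)) - sqrt M) / ?\<gamma> = (y1 - 1) / ?\<gamma> * sqrt M"
      using y by (simp add: real_sqrt_mult left_diff_distrib diff_divide_distrib)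
    also have "(y1 - 1) / ?\<gamma> = y1 * p * det A / A$1$1"
      using s_cases unfolding y1 \<gamma> by auto
    also have "\<dots> * sqrt M = sqrt ((y1 * p * det A / A$1$1)\<^sup>2 * M)"
      using y pos(1) a det_pos by (simp add: real_sqrt_mult p_def)
    also have "(y1 * p * det A / A$1$1)\<^sup>2 * M = 2 * det A * p * z"
      using y pos(1) a det_pos unfolding M p_def[symmetric]
      by (simp add: power2_eq_square field_simps)
    finally show ?thesis unfolding M_def p_def z_def .
  qed
  show ?thesis
  proof (intro conjI impI)
    assume "(x1, y1) \<notin> causal_future A"
    then have "(x1, y1) \<notin> top_of_set (carrier aff) interior_of causal_future A"
      using interior_of_subset[of "top_of_set (carrier aff)" "causal_future A"] by blast
    then show "lorentz_dist A \<one>\<^bsub>aff\<^esub> (x1, y1) = 0"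
      by (rule lorentz_dist_not_interior[OF assms(4)])
  next
    assume "(x1, y1) \<in> top_of_set (carrier aff) frontier_of causal_future A"
    then show "lorentz_dist A \<one>\<^bsub>aff\<^esub> (x1, y1) = 0"
      using lorentz_dist_not_interior[OF assms(4)] by (simp add: frontier_of_def)
  next
    assume int: "(x1, y1) \<in> top_of_set (carrier aff) interior_of causal_future A"
    then have "null_y (x1, y1) > 0" "null_x (x1, y1) > 0" by (simp_all add: interior_causal_future)
    then show "let \<alpha> = matrix_inv A $ 1 $ 1; \<beta> = matrix_inv A $ 1 $ 2; \<gamma> = matrix_inv A $ 2 $ 1;
             s1 = sgn \<gamma>;
             f = - (\<alpha> - s1 * \<beta>) / (2 * \<gamma>);
             g = - (\<alpha> + s1 * \<beta>) / (2 * \<gamma>);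
             w = (x1 - g * (1 - y1)) / f;
             \<tau> = sqrt (w / (y1 - y1\<^sup>2));
             \<rho> = sqrt (w * y1 / (1 - y1))
         in lorentz_dist A \<one>\<^bsub>aff\<^esub> (x1, y1) = ereal ((\<rho> - \<tau>) / \<gamma>)"
      unfolding Let_def sgn\<gamma> f g by (simp only: formula lorentz_dist_interior[OF int])
  qed (rule lorentz_dist_image_interior)
qed

end
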